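(* Let $A_k(x)$, $k\geq 0$, be a sequence of $C^1$ functions and let $x_0\in\mathbb{C}$ be such that $A_k(x_0)=0$ for all $k\geq 0$. Then $$H_n\big(A_k'(x_0)\big)=A_0'(x_0)^{n+1}\lim_{x\to x_0}\frac{H_n\big(A_k(x)\big)}{A_0(x)^{n+1}}.$$
   Context: For a sequence $(c_0,c_1,\ldots)$ of numbers or functions (indexed from $k=0$), $H_n(c_k)=\det\big(c_{i+j}\big)_{0\le i,j\le n}$ denotes its $n$th Hankel determinant.
   Formalization: It is assumed that A_0(x) is nonzero for x near x_0, x ≠ x_0; the identity is asserted whenever the limit exists, and existence of the limit is proved when A_0'(x_0) ≠ 0. Without this it fails: A_0=(x-x_0)^2, A_1=x-x_0, other A_k=0, n=1. *)

theory Defs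
  imports "HOL-Analysis.Analysis" "Jordan_Normal_Form.Determinant"
begin

text \<open>Indices run over \<open>0, \<dots>, n\<close>, so the matrix has size \<open>n + 1\<close>. The names are qualified because
  HOL-Analysis has its own constants \<open>det\<close> and \<open>mat\<close> for type-indexed matrices.\<close>

definition hankel_det :: "nat \<Rightarrow> (nat \<Rightarrow> 'a :: comm_ring_1) \<Rightarrow> 'a" where
  "hankel_det n c =
     Determinant.det (Matrix.mat (n + 1) (n + 1) (\<lambda>(i, j). c (i + j)))"

text \<open>Continuous differentiability with respect to a complex variable. The library's
  \<open>C1_differentiable_on\<close> concerns functions of a real variable.\<close>

definition complex_C1_on :: "(complex \<Rightarrow> complex) \<Rightarrow> complex set \<Rightarrow> bool" where
  "complex_C1_on f U \<longleftrightarrow>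
     (\<forall>x\<in>U. f field_differentiable (at x)) \<and> continuous_on U (deriv f)"

end

theory Submission
  imports Defs
begin

text \<open>The Hankel determinant is homogeneous of degree \<open>n + 1\<close> and continuous in the entries. Since
  all \<open>A k\<close> vanish at \<open>x0\<close>, dividing each entry by \<open>x - x0\<close> turns it into a difference quotient, so
  \<open>hankel_det n (A k x) / (x - x0)^(n + 1)\<close> tends to the determinant of the derivatives, and likewise
  \<open>A 0 x ^ (n + 1) / (x - x0)^(n + 1)\<close> tends to \<open>deriv (A 0) x0 ^ (n + 1)\<close>.\<close>

lemma hankel_det_cmult:
  "hankel_det n (\<lambda>k. a * c k) = a ^ (n + 1) * hankel_det n c"
proof -
  let ?M = "Matrix.mat (n + 1) (n + 1) (\<lambda>(i, j). c (i + j))"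
  have "Matrix.mat (n + 1) (n + 1) (\<lambda>(i, j). a * c (i + j)) = a \<cdot>\<^sub>m ?M"
    by (rule eq_matI) auto
  then show ?thesis
    by (simp add: hankel_det_def Determinant.det_smult)
qed

text \<open>By the Leibniz formula the determinant is a polynomial in finitely many entries, so
  limits pass through its sums and products.\<close>

lemma tendsto_hankel_det:
  fixes f :: "nat \<Rightarrow> 'b \<Rightarrow> 'a :: {comm_ring_1, real_normed_algebra}"
  assumes "\<And>k. (f k \<longlongrightarrow> c k) F"
  shows "((\<lambda>x. hankel_det n (\<lambda>k. f k x)) \<longlongrightarrow> hankel_det n c) F"
proof -
  have leibniz: "hankel_det n d = (\<Sum>p | p permutes {0..<n + 1}.
      signof p * (\<Prod>i = 0..<n + 1. d (i + p i)))" for d :: "nat \<Rightarrow> 'a"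
  proof -
    have "(\<Prod>i = 0..<n + 1. Matrix.mat (n + 1) (n + 1) (\<lambda>(i, j). d (i + j)) $$ (i, p i)) =
        (\<Prod>i = 0..<n + 1. d (i + p i))" if "p permutes {0..<n + 1}" for p
    proof (intro prod.cong refl)
      fix i assume "i \<in> {0..<n + 1}"
      \<comment> \<open>Matrix access is specified only within the dimensions, so the column index
        \<open>p i\<close> needs a bound too.\<close>
      moreover from this have "p i \<in> {0..<n + 1}"
        using permutes_in_image[OF that] by blast
      ultimately show "Matrix.mat (n + 1) (n + 1) (\<lambda>(i, j). d (i + j)) $$ (i, p i) = d (i + p i)"
        by simp
    qed
    then show ?thesis
      unfolding hankel_det_def
      by (subst Determinant.det_def'[of _ "n + 1"]) (auto intro!: sum.cong)
  qed
  show ?thesis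
    unfolding leibniz by (intro tendsto_intros assms)
qed

theorem theorem5p1:
  fixes A :: "nat \<Rightarrow> complex \<Rightarrow> complex" and U :: "complex set"
    and x0 :: complex and n :: nat
  assumes "open U" and "x0 \<in> U"
    and "\<And>k. complex_C1_on (A k) U"
    and "\<And>k. A k x0 = 0"
    and "\<forall>\<^sub>F x in at x0. A 0 x \<noteq> 0"
  shows "(deriv (A 0) x0 \<noteq> 0 \<longrightarrow>
            (\<exists>L. ((\<lambda>x. hankel_det n (\<lambda>k. A k x) / A 0 x ^ (n + 1)) \<longlongrightarrow> L) (at x0)))
       \<and> (\<forall>L. ((\<lambda>x. hankel_det n (\<lambda>k. A k x) / A 0 x ^ (n + 1)) \<longlongrightarrow> L) (at x0) \<longrightarrow>
            hankel_det n (\<lambda>k. deriv (A k) x0) = deriv (A 0) x0 ^ (n + 1) * L)"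
proof -
  \<comment> \<open>Since \<open>A k x0 = 0\<close>, this is the difference quotient at
    \<open>x0\<close>, written as a product so that \<open>hankel_det_cmult\<close> applies.\<close>
  define q where "q k x = inverse (x - x0) * A k x" for k x
  let ?H = "hankel_det n (\<lambda>k. deriv (A k) x0)"
  let ?R = "\<lambda>x. hankel_det n (\<lambda>k. A k x) / A 0 x ^ (n + 1)"
  have q: "(q k \<longlongrightarrow> deriv (A k) x0) (at x0)" for k
  proof -
    have "A k field_differentiable (at x0)"
      using assms(2,3) by (simp add: complex_C1_on_def)
    then have "(A k has_field_derivative deriv (A k) x0) (at x0)"
      by (rule field_differentiable_derivI)
    then show ?thesis
      by (simp add: has_field_derivative_iff assms(4) q_def [abs_def] field_simps)
  qed
  have num: "((\<lambda>x. hankel_det n (\<lambda>k. q k x)) \<longlongrightarrow> ?H) (at x0)"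
    by (rule tendsto_hankel_det) (rule q)
  have den: "((\<lambda>x. q 0 x ^ (n + 1)) \<longlongrightarrow> deriv (A 0) x0 ^ (n + 1)) (at x0)"
    by (intro tendsto_power q)
  \<comment> \<open>The factor \<open>inverse (x - x0) ^ (n + 1)\<close> cancels for
    \<open>x\<close> other than \<open>x0\<close>; where \<open>A 0 x = 0\<close>, both sides are 0
    by the convention for division by zero.\<close>
  have ratio: "\<forall>\<^sub>F x in at x0. hankel_det n (\<lambda>k. q k x) / q 0 x ^ (n + 1) = ?R x"
    using eventually_neq_at_within[of x0]
    by eventually_elim (simp add: q_def hankel_det_cmult power_mult_distrib del: power_Suc)
  \<comment> \<open>Here \<open>A 0 x ^ (n + 1)\<close> itself cancels, which requires
    \<open>A 0 x\<close> to be nonzero near \<open>x0\<close>.\<close>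
  have prod: "\<forall>\<^sub>F x in at x0. q 0 x ^ (n + 1) * ?R x = hankel_det n (\<lambda>k. q k x)"
    using assms(5)
    by eventually_elim (simp add: q_def hankel_det_cmult power_mult_distrib del: power_Suc)
  show ?thesis
  proof (intro conjI impI allI)
    assume "deriv (A 0) x0 \<noteq> 0"
    then have "((\<lambda>x. hankel_det n (\<lambda>k. q k x) / q 0 x ^ (n + 1)) \<longlongrightarrow>
        ?H / deriv (A 0) x0 ^ (n + 1)) (at x0)"
      by (intro tendsto_divide num den) simp
    then show "\<exists>L. (?R \<longlongrightarrow> L) (at x0)"
      using tendsto_cong[OF ratio] by blast
  next
    fix L
    assume "(?R \<longlongrightarrow> L) (at x0)"
    \<comment> \<open>Multiplying by the denominator instead of dividing by its limit also covers
      \<open>deriv (A 0) x0 = 0\<close>.\<close>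
    then have "((\<lambda>x. q 0 x ^ (n + 1) * ?R x) \<longlongrightarrow> deriv (A 0) x0 ^ (n + 1) * L) (at x0)"
      by (intro tendsto_mult den)
    then have "((\<lambda>x. hankel_det n (\<lambda>k. q k x)) \<longlongrightarrow> deriv (A 0) x0 ^ (n + 1) * L) (at x0)"
      using tendsto_cong[OF prod] by blast
    with num show "?H = deriv (A 0) x0 ^ (n + 1) * L"
      by (intro tendsto_unique[OF at_neq_bot])
  qed
qed

end
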